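(* Let $p$ be an odd prime and let $\alpha>0$ and $k>0$ be integers. Then: (1) $U^{k}(\mathbb{Z}_{p^{\alpha}})\approx U^{k}(\mathbb{Z}_{p})\times U^{k-1}(\mathbb{Z}_{p})\times\cdots\times U^{k-\alpha+1}(\mathbb{Z}_{p})$ when $\alpha<k$; (2) $U^{k}(\mathbb{Z}_{p^{\alpha}})\approx U^{k}(\mathbb{Z}_{p})\times U^{k-1}(\mathbb{Z}_{p})\times\cdots\times U^{2}(\mathbb{Z}_{p})\times U(\mathbb{Z}_{p})$ when $\alpha=k$; (3) $U^{k}(\mathbb{Z}_{p^{\alpha}})\approx U^{k}(\mathbb{Z}_{p})\times U^{k-1}(\mathbb{Z}_{p})\times\cdots\times U(\mathbb{Z}_{p})\times\mathbb{Z}_{p^{\alpha-k}}$ when $\alpha>k$.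
   Context: For an integer $n\ge 1$, $\mathbb{Z}_n$ is the ring of integers modulo $n$ ($\mathbb{Z}_1=\{0\}$). For a finite commutative ring $R$ with identity (the zero ring is allowed, with $U(\{0\})=\{0\}$), $U(R)$ is its group of units. Since $U(R)$ is a finite abelian group, it is isomorphic to a product $\mathbb{Z}_{n_1}\times\cdots\times\mathbb{Z}_{n_i}$ of cyclic groups, and $U(R)$ is regarded as a ring by transporting the ring structure of $\mathbb{Z}_{n_1}\oplus\cdots\oplus\mathbb{Z}_{n_i}$ (up to ring isomorphism this does not depend on the chosen decomposition). The $k$-th (generalized) group of units is defined by $U^0(R)=R$, $U^1(R)=U(R)$ and $U^k(R)=U(U^{k-1}(R))$, where $U^{k-1}(R)$ is viewed as a ring in this way. The symbol $\approx$ denotes isomorphism (as groups, equivalently as rings with these structures). In each product the exponents of $U$ decrease by one from factor to factor: the product in (1) is over $U^{j}(\mathbb{Z}_p)$ for $k-\alpha+1\le j\le k$, and in (2) and (3) it is over $U^{j}(\mathbb{Z}_p)$ for $1\le j\le k$ (with the extra factor $\mathbb{Z}_{p^{\alpha-k}}$ in (3)). *)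

theory Defs
  imports "HOL-Algebra.Chinese_Remainder" "HOL-Algebra.IntRing"
begin

text \<open>
  The ring \<open>\<int>\<^bsub>n\<^esub>\<close> is \<open>ZFact (int n)\<close>, which for \<open>n = 1\<close> is the zero ring
  (whereas \<open>residue_ring 1\<close> is not a ring, since its unit lies outside its carrier).
\<close>

definition cyclic_sum :: "nat list \<Rightarrow> int set list ring"
  where "cyclic_sum ns = RDirProd_list (map (\<lambda>n. ZFact (int n)) ns)"

definition cyclic_decomp ::
  "('a, 'm) ring_scheme \<Rightarrow> nat list \<Rightarrow> ('a \<Rightarrow> int set list) \<Rightarrow> bool"
  where "cyclic_decomp R ns f \<longleftrightarrow>
    (\<forall>n\<in>set ns. 1 \<le> n) \<and> f \<in> iso (units_of R) (add_monoid (cyclic_sum ns))"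

text \<open>
  \<open>U(R)\<close> as a ring on the carrier \<open>Units R\<close>: its addition is the multiplication of \<open>R\<close>,
  and its multiplication and unit are pulled back along an arbitrarily chosen cyclic
  decomposition. One exists whenever \<open>R\<close> is a finite commutative ring (the list \<open>ns\<close> may be
  empty, giving the zero ring), and the choice does not matter up to ring isomorphism.
\<close>

definition unit_ring :: "('a, 'm) ring_scheme \<Rightarrow> 'a ring"
  where "unit_ring R =
    (let (ns, f) = (SOME (ns, f). cyclic_decomp R ns f);
         S = cyclic_sum ns;
         g = inv_into (Units R) f
     in \<lparr> carrier = Units R,
          monoid.mult = (\<lambda>x y. g (f x \<otimes>\<^bsub>S\<^esub> f y)),
          one = g \<one>\<^bsub>S\<^esub>,
          zero = \<one>\<^bsub>R\<^esub>,
          add = (\<otimes>\<^bsub>R\<^esub>) \<rparr>)"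

lemma add_monoid_unit_ring: "add_monoid (unit_ring R) = units_of R"
  by (simp add: unit_ring_def units_of_def Let_def split_beta)

primrec gen_units :: "nat \<Rightarrow> 'a ring \<Rightarrow> 'a ring"
  where
    "gen_units 0 R = R"
  | "gen_units (Suc k) R = unit_ring (gen_units k R)"

end

theory Submission
  imports Defs "HOL-Number_Theory.Residue_Primitive_Roots" "HOL-Number_Theory.Prime_Powers"
begin

text \<open>
  The unit group of \<open>\<int>\<close> modulo \<open>p\<^sup>a\<^sup>+\<^sup>1\<close> is cyclic of order \<open>(p - 1) p\<^sup>a\<close>, because \<open>p\<close> is odd
  and so there is a primitive root. Since \<open>p - 1\<close> and \<open>p\<^sup>a\<close> are coprime, the Chinese remainder
  theorem splits its ring into the unit ring of \<open>\<int>\<close> modulo \<open>p\<close> and a copy of \<open>\<int>\<close> modulo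
  \<open>p\<^sup>a\<close> (\<open>unit_ring_ZFact_split\<close>). Formation of units commutes with finite direct products, so a
  further application raises by one the exponent of every factor already split off and splits one
  more factor from the remaining residue ring. Hence each of the first \<open>\<alpha>\<close> steps adds one factor;
  afterwards the residue ring is trivial and every step just raises all exponents.

  The work lies in justifying the two rules of this calculus, that units commute with products and
  that they respect isomorphism, for rings whose multiplication comes from an arbitrarily chosen
  cyclic decomposition. Two facts are needed, both for the class \<open>sum_of_cyclics\<close> of rings that
  are isomorphic to finite sums of residue rings of prime power order.

  Uniqueness (\<open>sum_of_cyclics_unique\<close>): such a ring is determined by its additive group. The
  number of elements killed by \<open>d\<close> in a sum of residue rings modulo \<open>n\<^sub>1, \<dots>, n\<^sub>r\<close> is the
  product of the \<open>gcd d n\<^sub>i\<close>, and for powers \<open>d\<close> of a prime these numbers reveal how often each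
  prime power occurs among the \<open>n\<^sub>i\<close>.

  Existence (\<open>sum_of_cyclics_unit_ring\<close>): the unit group of such a ring is again a sum of cyclic
  groups. This reduces to prime power moduli, where there is a primitive root except for
  \<open>2\<^sup>k\<close> with \<open>k \<ge> 3\<close>; there \<open>- 1\<close> and \<open>5\<close> generate the units. Powers of two cannot be avoided,
  as \<open>p - 1\<close> is even and has to be treated from the second step on.
\<close>

declare ring_iso_trans [trans]

section \<open>Isomorphic rings and their groups\<close>

lemma add_monoid_iso: "R \<simeq> S \<Longrightarrow> add_monoid R \<cong> add_monoid S"
proof -
  assume "R \<simeq> S"
  then obtain h where "h \<in> ring_iso R S"
    unfolding is_ring_iso_def by blast
  hence "h \<in> iso (add_monoid R) (add_monoid S)"
    unfolding iso_def hom_def ring_iso_def ring_hom_def by simp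
  thus ?thesis
    unfolding is_iso_def by blast
qed

lemma ring_iso_Units_subset:
  assumes "monoid R" and "h \<in> ring_hom R S"
  shows "h ` Units R \<subseteq> Units S"
proof
  interpret monoid R by fact
  fix y assume "y \<in> h ` Units R"
  then obtain x where x: "x \<in> Units R" "y = h x" by blast
  have "h (inv\<^bsub>R\<^esub> x) \<otimes>\<^bsub>S\<^esub> h x = \<one>\<^bsub>S\<^esub>" "h x \<otimes>\<^bsub>S\<^esub> h (inv\<^bsub>R\<^esub> x) = \<one>\<^bsub>S\<^esub>"
    using x ring_hom_mult[OF assms(2)] ring_hom_one[OF assms(2)]
    by (metis Units_closed Units_inv_closed Units_l_inv Units_r_inv)+
  moreover have "h x \<in> carrier S" "h (inv\<^bsub>R\<^esub> x) \<in> carrier S"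
    using x by (auto intro!: ring_hom_closed[OF assms(2)])
  ultimately show "y \<in> Units S"
    unfolding Units_def x(2) by (intro CollectI conjI bexI[of _ "h (inv\<^bsub>R\<^esub> x)"])
qed

lemma units_of_iso:
  assumes "ring R" and "ring S" and "R \<simeq> S"
  shows "units_of R \<cong> units_of S"
proof -
  obtain h where h: "h \<in> ring_iso R S"
    using assms(3) unfolding is_ring_iso_def by blast
  have hom: "h \<in> ring_hom R S" and bij: "bij_betw h (carrier R) (carrier S)"
    using h unfolding ring_iso_def by auto
  have mR: "monoid R" and mS: "monoid S"
    using assms ring.axioms(2) by auto
  have inv: "inv_into (carrier R) h \<in> ring_hom S R"
    using ring_iso_set_sym[OF assms(1) h] unfolding ring_iso_def by auto
  have sub: "Units R \<subseteq> carrier R" "Units S \<subseteq> carrier S"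
    unfolding Units_def by auto
  have "Units S \<subseteq> h ` Units R"
  proof
    fix y assume y: "y \<in> Units S"
    have "inv_into (carrier R) h y \<in> Units R"
      using ring_iso_Units_subset[OF mS inv] y by blast
    moreover have "h (inv_into (carrier R) h y) = y"
      using y sub bij by (metis bij_betw_inv_into_right subsetD)
    ultimately show "y \<in> h ` Units R" by force
  qed
  hence "h ` Units R = Units S"
    using ring_iso_Units_subset[OF mR hom] by blast
  hence "bij_betw h (Units R) (Units S)"
    using bij_betw_subset[OF bij sub(1)] by blast
  moreover have "h (x \<otimes>\<^bsub>R\<^esub> y) = h x \<otimes>\<^bsub>S\<^esub> h y" if "x \<in> Units R" "y \<in> Units R" for x y
    using that sub ring_hom_mult[OF hom] by blast
  ultimately have "h \<in> iso (units_of R) (units_of S)"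
    unfolding iso_def hom_def units_of_def by (auto simp: bij_betw_def)
  thus ?thesis unfolding is_iso_def by blast
qed

lemma DirProd_is_iso:
  assumes "G \<cong> G'" and "H \<cong> H'"
  shows "G \<times>\<times> H \<cong> G' \<times>\<times> H'"
proof -
  obtain f g where "f \<in> iso G G'" "g \<in> iso H H'"
    using assms unfolding is_iso_def by blast
  hence hom: "f \<in> hom G G'" "g \<in> hom H H'"
    and bij: "bij_betw f (carrier G) (carrier G')" "bij_betw g (carrier H) (carrier H')"
    unfolding iso_def by auto
  have "bij_betw (map_prod f g) (carrier G \<times> carrier H) (carrier G' \<times> carrier H')"
    by (rule bij_betw_map_prod[OF bij])
  moreover have "map_prod f g \<in> hom (G \<times>\<times> H) (G' \<times>\<times> H')"
    using hom unfolding hom_def by auto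
  ultimately have "map_prod f g \<in> iso (G \<times>\<times> H) (G' \<times>\<times> H')"
    unfolding iso_def by (simp add: DirProd_def)
  thus ?thesis unfolding is_iso_def by blast
qed

lemma units_of_RDirProd:
  "units_of (RDirProd R S) = units_of R \<times>\<times> units_of S"
proof -
  have "(x, y) \<in> Units (RDirProd R S) \<longleftrightarrow> x \<in> Units R \<and> y \<in> Units S" for x y
    by (auto simp add: Units_def RDirProd_def DirProd_def monoid.defs)
  hence "Units (RDirProd R S) = Units R \<times> Units S"
    by auto
  thus ?thesis
    by (simp add: units_of_def DirProd_def RDirProd_def monoid.defs)
qed

section \<open>Direct products of rings\<close>

lemma RDirProd_cong: "R \<simeq> R' \<Longrightarrow> S \<simeq> S' \<Longrightarrow> RDirProd R S \<simeq> RDirProd R' S'"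
  using RDirProd_iso6 unfolding is_ring_iso_def by blast

lemma RDirProd_commute: "RDirProd R S \<simeq> RDirProd S R"
  using RDirProd_iso1 unfolding is_ring_iso_def by blast

lemma RDirProd_assoc: 
  "RDirProd R (RDirProd S T) \<simeq> RDirProd (RDirProd R S) T"
  "RDirProd (RDirProd R S) T \<simeq> RDirProd R (RDirProd S T)"
  using RDirProd_iso2 RDirProd_iso3 unfolding is_ring_iso_def by blast+

lemma RDirProd_list_Cons:
  "RDirProd_list (R # Rs) \<simeq> RDirProd R (RDirProd_list Rs)"
  "RDirProd R (RDirProd_list Rs) \<simeq> RDirProd_list (R # Rs)"
  using RDirProd_list_iso1 RDirProd_list_iso2 unfolding is_ring_iso_def by blast+

lemma RDirProd_list_ring: "(\<forall>R\<in>set Rs. ring R) \<Longrightarrow> ring (RDirProd_list Rs)"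
  by (rule RDirProd_list_is_ring) auto

lemma RDirProd_list_cong:
  "list_all2 (\<lambda>R S. R \<simeq> S) Rs Ss \<Longrightarrow> RDirProd_list Rs \<simeq> RDirProd_list Ss"
proof (induction rule: list_all2_induct)
  case Nil
  have "(\<lambda>_. []) \<in> ring_iso (nil_ring :: 'a list ring) (nil_ring :: 'c list ring)"
    by (intro ring_iso_memI) (auto simp: monoid.defs bij_betw_def)
  thus ?case unfolding is_ring_iso_def by auto
next
  case (Cons R Rs S Ss)
  thus ?case
    by (intro ring_iso_trans[OF RDirProd_list_Cons(1)
          ring_iso_trans[OF RDirProd_cong RDirProd_list_Cons(2)]])
qed

lemma RDirProd_list_append:
  "RDirProd_list (Rs @ Ss) \<simeq> RDirProd (RDirProd_list Rs) (RDirProd_list Ss)"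
proof (induction Rs)
  case Nil
  have "RDirProd_list Ss \<simeq> RDirProd (RDirProd_list Ss) nil_ring"
    using RDirProd_iso7 unfolding is_ring_iso_def by blast
  thus ?case using RDirProd_commute ring_iso_trans by fastforce
next
  case (Cons R Rs)
  have "RDirProd_list ((R # Rs) @ Ss) \<simeq> RDirProd R (RDirProd_list (Rs @ Ss))"
    using RDirProd_list_Cons by simp
  also note RDirProd_cong[OF ring_iso_refl Cons.IH]
  also note RDirProd_assoc(1)
  also note RDirProd_cong[OF RDirProd_list_Cons(2) ring_iso_refl]
  finally show ?case .
qed

lemma RDirProd_list_move_to_front:
  assumes "\<forall>R\<in>set (Rs @ S # Ss). ring R"
  shows "RDirProd_list (S # Rs @ Ss) \<simeq> RDirProd_list (Rs @ S # Ss)"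
proof -
  have rings: "ring (RDirProd_list Rs)" "ring (RDirProd_list Ss)" "ring (RDirProd_list (Rs @ Ss))"
      "ring (RDirProd_list (Rs @ S # Ss))"
    by (rule RDirProd_list_ring, use assms in force)+
  let ?P = RDirProd_list
  have "?P (Rs @ S # Ss) \<simeq> RDirProd (?P Rs) (?P (S # Ss))"
    by (rule RDirProd_list_append)
  also have "\<dots> \<simeq> RDirProd (?P Rs) (RDirProd S (?P Ss))"
    by (rule RDirProd_cong[OF ring_iso_refl RDirProd_list_Cons(1)])
  also have "\<dots> \<simeq> RDirProd (RDirProd (?P Rs) S) (?P Ss)"
    by (rule RDirProd_assoc(1))
  also have "\<dots> \<simeq> RDirProd (RDirProd S (?P Rs)) (?P Ss)"
    by (rule RDirProd_cong[OF RDirProd_commute ring_iso_refl])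
  also have "\<dots> \<simeq> RDirProd S (RDirProd (?P Rs) (?P Ss))"
    by (rule RDirProd_assoc(2))
  also have "\<dots> \<simeq> RDirProd S (?P (Rs @ Ss))"
    by (rule RDirProd_cong[OF ring_iso_refl ring_iso_sym[OF rings(3) RDirProd_list_append]])
  also have "\<dots> \<simeq> ?P (S # Rs @ Ss)"
    by (rule RDirProd_list_Cons(2))
  finally show ?thesis by (rule ring_iso_sym[OF rings(4)])
qed

text \<open>
  The order of the factors is irrelevant. This is what turns an equality of multisets of prime
  powers into an isomorphism of rings.
\<close>

lemma RDirProd_list_map_mset:
  assumes "\<And>i. ring (F i)" and "mset is = mset js"
  shows "RDirProd_list (map F is) \<simeq> RDirProd_list (map F js)"
  using assms(2)
proof (induction "is" arbitrary: js)
  case Nil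
  thus ?case by (simp add: ring_iso_refl)
next
  case (Cons i "is")
  have "i \<in> set js"
    using Cons.prems by (metis list.set_intros(1) mset_eq_setD)
  then obtain js1 js2 where js: "js = js1 @ i # js2"
    by (meson split_list)
  hence "mset is = mset (js1 @ js2)"
    using Cons.prems by simp
  hence "RDirProd_list (map F is) \<simeq> RDirProd_list (map F (js1 @ js2))"
    by (rule Cons.IH)
  hence "RDirProd_list (map F (i # is)) \<simeq> RDirProd_list (F i # map F js1 @ map F js2)"
    unfolding list.map js map_append[symmetric]
    by (rule ring_iso_trans[OF RDirProd_list_Cons(1)
          ring_iso_trans[OF RDirProd_cong[OF ring_iso_refl] RDirProd_list_Cons(2)]])
  also have "\<dots> \<simeq> RDirProd_list (map F js)"
    using RDirProd_list_move_to_front[of "map F js1" "F i" "map F js2"] assms(1) js by auto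
  finally show ?case .
qed

section \<open>Residue rings\<close>

lemma ring_ZFact: "ring (ZFact n)"
  using ZFact_is_cring cring.axioms(1) by blast

lemma carrier_ZFact: "carrier (ZFact n) = range (ZMod n)"
  unfolding ZFact_def FactRing_def A_RCOSETS_def' ZMod_def by auto

lemma ZFact_add [simp]: "ZMod n a \<oplus>\<^bsub>ZFact n\<^esub> ZMod n b = ZMod n (a + b)"
proof -
  interpret ideal "Idl\<^bsub>\<Z>\<^esub> {n}" \<Z>
    by (rule int.genideal_ideal) simp
  show ?thesis
    using a_rcos_sum[of a b] unfolding ZFact_def FactRing_def ZMod_def by simp
qed

lemma ZFact_mult [simp]: "ZMod n a \<otimes>\<^bsub>ZFact n\<^esub> ZMod n b = ZMod n (a * b)"
proof -
  interpret ideal "Idl\<^bsub>\<Z>\<^esub> {n}" \<Z>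
    by (rule int.genideal_ideal) simp
  show ?thesis
    using rcoset_mult_add[of a b] unfolding ZFact_def FactRing_def ZMod_def by simp
qed

lemma ZFact_one_eq: "\<one>\<^bsub>ZFact n\<^esub> = ZMod n 1"
  unfolding ZFact_def FactRing_def ZMod_def by simp

lemma ZFact_zero_eq: "\<zero>\<^bsub>ZFact n\<^esub> = ZMod n 0"
proof -
  interpret ideal "Idl\<^bsub>\<Z>\<^esub> {n}" \<Z>
    by (rule int.genideal_ideal) simp
  have "ring (ZFact n)" by (rule ring_ZFact)
  then interpret Q: ring "ZFact n" .
  have "ZMod n 0 \<oplus>\<^bsub>ZFact n\<^esub> ZMod n 0 = ZMod n 0" by simp
  moreover have "ZMod n 0 \<in> carrier (ZFact n)" by (simp add: carrier_ZFact)
  ultimately show ?thesis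
    using Q.add.r_cancel_one by metis
qed

text \<open>
  Functions on a residue ring are given by functions on the integers with the matching fibres;
  this avoids any computation with cosets in the constructions of isomorphisms below.
\<close>

lemma ZMod_lift:
  assumes "\<And>x y. h x = h y \<longleftrightarrow> x mod n = y mod n"
  obtains f where "\<And>x. f (ZMod n x) = h x" and "bij_betw f (carrier (ZFact n)) (range h)"
proof
  define f where "f X = h (SOME x. X = ZMod n x)" for X
  show fx: "f (ZMod n x) = h x" for x
  proof -
    have "ZMod n x = ZMod n (SOME y. ZMod n x = ZMod n y)"
      by (rule someI[of _ x]) simp
    thus ?thesis unfolding f_def using assms ZMod_eq_mod by metis
  qed
  show "bij_betw f (carrier (ZFact n)) (range h)"
    unfolding bij_betw_def inj_on_def carrier_ZFact
    by (auto simp: fx assms ZMod_eq_mod image_iff)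
qed

lemma ZFact_coprime_mult:
  assumes "coprime a b"
  shows "ZFact (a * b) \<simeq> RDirProd (ZFact a) (ZFact b)"
proof -
  define h where "h x = (ZMod a x, ZMod b x)" for x
  have h_eq: "h x = h y \<longleftrightarrow> x mod (a * b) = y mod (a * b)" for x y
    using divides_mult[OF _ _ assms, of "x - y"] dvd_mult_left[of a b "x - y"]
      dvd_mult_right[of a b "x - y"]
    unfolding h_def prod.inject ZMod_eq_mod mod_eq_dvd_iff by blast
  obtain f where f: "\<And>x. f (ZMod (a * b) x) = h x"
    "bij_betw f (carrier (ZFact (a * b))) (range h)"
    using ZMod_lift[of h, OF h_eq] by blast
  have "range h = carrier (ZFact a) \<times> carrier (ZFact b)"
  proof (intro equalityI subsetI)
    fix z assume "z \<in> carrier (ZFact a) \<times> carrier (ZFact b)"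
    then obtain x y where z: "z = (ZMod a x, ZMod b y)"
      unfolding carrier_ZFact by blast
    \<comment> \<open>The Bezout coefficients give the explicit solution \<open>x + (y - x) u a\<close> of the two congruences.\<close>
    obtain u v where uv: "u * a + v * b = 1"
      using bezout_int[of a b] assms by auto
    have "x + (y - x) * (u * a) - y = (x - y) * (1 - u * a)"
      by (simp add: algebra_simps)
    also have "1 - u * a = v * b"
      using uv by simp
    finally have "x + (y - x) * (u * a) - y = (x - y) * (v * b)" .
    hence "h (x + (y - x) * (u * a)) = z"
      by (auto simp: h_def z ZMod_eq_mod mod_eq_dvd_iff)
    thus "z \<in> range h" by blast
  qed (auto simp: h_def carrier_ZFact)
  hence "bij_betw f (carrier (ZFact (a * b))) (carrier (RDirProd (ZFact a) (ZFact b)))"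
    using f by (simp add: RDirProd_carrier)
  hence "f \<in> ring_iso (ZFact (a * b)) (RDirProd (ZFact a) (ZFact b))"
    by (intro ring_iso_memI)
       (auto simp: carrier_ZFact f h_def RDirProd_def DirProd_def monoid.defs ZFact_one_eq)
  thus ?thesis unfolding is_ring_iso_def by blast
qed

lemma ZFact_1_nil: "ZFact 1 \<simeq> nil_ring"
proof -
  have "(\<lambda>_. []) \<in> ring_iso (ZFact 1) (nil_ring :: 'a list ring)"
    by (intro ring_iso_memI) (auto simp: monoid.defs bij_betw_def ZFact_one)
  thus ?thesis unfolding is_ring_iso_def by auto
qed

lemma RDirProd_ZFact_1:
  assumes "ring R"
  shows "RDirProd R (ZFact 1) \<simeq> R"
proof -
  have "RDirProd R (ZFact 1) \<simeq> RDirProd R nil_ring"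
    by (rule RDirProd_cong[OF ring_iso_refl ZFact_1_nil])
  also have "\<dots> \<simeq> R"
    using RDirProd_iso7 by (intro ring_iso_sym[OF assms]) (auto simp: is_ring_iso_def)
  finally show ?thesis .
qed

lemma bij_betw_ZMod:
  assumes "n > 0"
  shows "bij_betw (ZMod n) {0..<n} (carrier (ZFact n))"
proof -
  have "ZMod n x \<in> ZMod n ` {0..<n}" for x
    using assms ZMod_mod[of n x] by (intro image_eqI[of _ _ "x mod n"]) auto
  thus ?thesis
    unfolding bij_betw_def inj_on_def carrier_ZFact by (auto simp: ZMod_eq_mod)
qed

section \<open>Torsion counts\<close>

text \<open>
  An isomorphism invariant of groups that is multiplicative on direct products and that can be
  computed for cyclic groups. For a commutative group it is the size of the \<open>q\<close>-torsion subgroup.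
\<close>

definition torsion_count :: "('a, 'm) monoid_scheme \<Rightarrow> nat \<Rightarrow> nat"
  where "torsion_count G q = card {x \<in> carrier G. x [^]\<^bsub>G\<^esub> q = \<one>\<^bsub>G\<^esub>}"

lemma torsion_count_iso:
  assumes "Group.group G" and "Group.group H" and "G \<cong> H"
  shows "torsion_count G q = torsion_count H q"
proof -
  obtain h where h: "h \<in> iso G H"
    using assms(3) unfolding is_iso_def by blast
  interpret group_hom G H h
    using h assms unfolding iso_def by (simp add: group_hom_def group_hom_axioms_def)
  have bij: "bij_betw h (carrier G) (carrier H)"
    using h unfolding iso_def by simp
  have "h x [^]\<^bsub>H\<^esub> q = \<one>\<^bsub>H\<^esub> \<longleftrightarrow> x [^]\<^bsub>G\<^esub> q = \<one>\<^bsub>G\<^esub>" if "x \<in> carrier G" for x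
    using that bij unfolding bij_betw_def
    by (metis G.nat_pow_closed G.one_closed hom_nat_pow hom_one inj_onD)
  hence "bij_betw h {x \<in> carrier G. x [^]\<^bsub>G\<^esub> q = \<one>\<^bsub>G\<^esub>} {x \<in> carrier H. x [^]\<^bsub>H\<^esub> q = \<one>\<^bsub>H\<^esub>}"
    by (intro bij_betw_Collect[OF bij]) 
  thus ?thesis
    unfolding torsion_count_def by (rule bij_betw_same_card)
qed

lemma torsion_count_DirProd:
  "torsion_count (G \<times>\<times> H) q = torsion_count G q * torsion_count H q"
proof -
  have pow: "(x, y) [^]\<^bsub>G \<times>\<times> H\<^esub> q = (x [^]\<^bsub>G\<^esub> q, y [^]\<^bsub>H\<^esub> q)" for x y
    by (induction q) (simp_all add: nat_pow_def)
  have "{z \<in> carrier (G \<times>\<times> H). z [^]\<^bsub>G \<times>\<times> H\<^esub> q = \<one>\<^bsub>G \<times>\<times> H\<^esub>} =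
    {x \<in> carrier G. x [^]\<^bsub>G\<^esub> q = \<one>\<^bsub>G\<^esub>} \<times> {x \<in> carrier H. x [^]\<^bsub>H\<^esub> q = \<one>\<^bsub>H\<^esub>}"
    by (auto simp: pow)
  thus ?thesis
    unfolding torsion_count_def by (simp add: card_cartesian_product)
qed

lemma ZFact_add_pow: "ZMod n x [^]\<^bsub>add_monoid (ZFact n)\<^esub> (q :: nat) = ZMod n (int q * x)"
  by (induction q) (simp_all add: nat_pow_def ZFact_zero_eq algebra_simps)

lemma torsion_count_ZFact:
  assumes "n > 0"
  shows "torsion_count (add_monoid (ZFact (int n))) q = gcd q n"
proof -
  define d where "d = gcd q n"
  have "d > 0" using assms by (simp add: d_def)
  obtain a b where ab: "q = a * d" "n = b * d" "coprime a b"
    using gcd_coprime_exists[of q n] \<open>d > 0\<close> unfolding d_def by auto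
  have "b > 0" using ab assms by (cases b) auto
  \<comment> \<open>The residues killed by \<open>q\<close> are the multiples of \<open>n div gcd q n\<close>.\<close>
  have div: "int n dvd int q * x \<longleftrightarrow> int b dvd x" for x
  proof -
    have "int n dvd int q * x \<longleftrightarrow> int d * int b dvd int d * (int a * x)"
      using ab by (simp add: mult_ac)
    also have "\<dots> \<longleftrightarrow> int b dvd int a * x"
      using \<open>d > 0\<close> by (subst dvd_times_left_cancel_iff) auto
    also have "\<dots> \<longleftrightarrow> int b dvd x"
      using ab(3) by (intro coprime_dvd_mult_right_iff) (simp add: coprime_commute)
    finally show ?thesis .
  qed
  have bij: "bij_betw (ZMod (int n)) {0..<int n} (carrier (ZFact (int n)))"
    using assms by (intro bij_betw_ZMod) simp
  have "{X \<in> carrier (add_monoid (ZFact (int n))). X [^]\<^bsub>add_monoid (ZFact (int n))\<^esub> q = \<one>\<^bsub>add_monoid (ZFact (int n))\<^esub>}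
     = ZMod (int n) ` {x \<in> {0..<int n}. int b dvd x}"
  proof -
    have "ZMod (int n) x [^]\<^bsub>add_monoid (ZFact (int n))\<^esub> q = \<one>\<^bsub>add_monoid (ZFact (int n))\<^esub> \<longleftrightarrow> int b dvd x" for x
      unfolding ZFact_add_pow using div[of x] by (simp add: ZFact_zero_eq ZMod_eq_mod dvd_eq_mod_eq_0)
    moreover have "carrier (add_monoid (ZFact (int n))) = ZMod (int n) ` {0..<int n}"
      using bij by (simp add: bij_betw_def)
    ultimately show ?thesis by auto
  qed
  also have "card \<dots> = card {x \<in> {0..<int n}. int b dvd x}"
    using bij unfolding bij_betw_def by (intro card_image) (auto intro: inj_on_subset)
  also have "{x \<in> {0..<int n}. int b dvd x} = (\<lambda>i. int b * i) ` {0..<int d}"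
  proof -
    have "int b * i < int n \<longleftrightarrow> i < int d" for i
      using \<open>b > 0\<close> ab by (simp add: mult.commute[of "int d"] del: of_nat_mult add: of_nat_mult)
    moreover have "0 \<le> int b * i \<longleftrightarrow> 0 \<le> i" for i
      using \<open>b > 0\<close> by (simp add: zero_le_mult_iff)
    ultimately show ?thesis by (auto elim!: dvdE)
  qed
  also have "card \<dots> = d"
    using \<open>b > 0\<close> by (subst card_image) (auto simp: inj_on_def)
  finally show ?thesis unfolding torsion_count_def d_def .
qed

lemma group_add_monoid: "ring R \<Longrightarrow> Group.group (add_monoid R)"
  using ring.is_abelian_group abelian_group.a_group by blast

lemma ring_cyclic_sum: "ring (cyclic_sum ns)"
  unfolding cyclic_sum_def by (intro RDirProd_list_ring) (auto simp: ring_ZFact)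

lemma cyclic_sum_Cons:
  "cyclic_sum (n # ns) \<simeq> RDirProd (ZFact (int n)) (cyclic_sum ns)"
  unfolding cyclic_sum_def list.map by (rule RDirProd_list_Cons)

lemma torsion_count_cyclic_sum:
  assumes "\<forall>n\<in>set ns. n > 0"
  shows "torsion_count (add_monoid (cyclic_sum ns)) q = (\<Prod>n\<leftarrow>ns. gcd q n)"
  using assms
proof (induction ns)
  case Nil
  let ?G = "add_monoid (nil_ring :: int set list ring)"
  have "Group.group ?G"
    using group_add_monoid[OF RDirProd_list_ring[of "[]"]] by simp
  moreover have "carrier ?G = {[]}" "\<one>\<^bsub>?G\<^esub> = []"
    by (simp_all add: monoid.defs)
  ultimately have "{x \<in> carrier ?G. x [^]\<^bsub>?G\<^esub> q = \<one>\<^bsub>?G\<^esub>} = {[]}"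
    using monoid.nat_pow_closed[OF group.is_monoid, of ?G "[]" q] by auto
  thus ?case
    by (simp add: torsion_count_def cyclic_sum_def)
next
  case (Cons n ns)
  have "torsion_count (add_monoid (cyclic_sum (n # ns))) q
      = torsion_count (add_monoid (RDirProd (ZFact (int n)) (cyclic_sum ns))) q"
    by (intro torsion_count_iso group_add_monoid ring_cyclic_sum RDirProd_ring ring_ZFact
          add_monoid_iso cyclic_sum_Cons)
  also have "\<dots> = gcd q n * (\<Prod>n\<leftarrow>ns. gcd q n)"
    unfolding RDirProd_add_monoid torsion_count_DirProd
    using Cons.IH Cons.prems torsion_count_ZFact[of n q] by (metis list.set_intros)
  finally show ?case by simp
qed

section \<open>Prime powers\<close>

lemma gcd_prime_power:
  fixes p n :: nat
  assumes "Factorial_Ring.prime p" and "n > 0"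
  shows "gcd (p ^ k) n = p ^ min k (multiplicity p n)"
proof -
  obtain m where m: "n = p ^ multiplicity p n * m" "\<not> p dvd m"
    using multiplicity_decompose'[of n p] assms by (metis not_prime_unit not_gr_zero)
  have "coprime (p ^ k) m"
    using assms(1) m(2) by (simp add: prime_imp_coprime)
  hence "gcd (p ^ k) n = gcd (p ^ k) (p ^ multiplicity p n)"
    by (subst m(1)) (simp add: gcd_mult_right_right_cancel)
  also have "\<dots> = p ^ min k (multiplicity p n)"
    by (cases "k \<le> multiplicity p n")
       (simp_all add: le_imp_power_dvd gcd_nat.absorb1 gcd_nat.absorb2 min_def)
  finally show ?thesis .
qed

lemma prod_gcd_prime_power:
  fixes p :: nat
  assumes "Factorial_Ring.prime p" and "\<forall>n\<in>set ns. n > 0"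
  shows "(\<Prod>n\<leftarrow>ns. gcd (p ^ k) n) = p ^ (\<Sum>n\<leftarrow>ns. min k (multiplicity p n))"
  using assms(2) by (induction ns) (simp_all add: gcd_prime_power[OF assms(1)] power_add)

text \<open>
  As a function of \<open>k\<close>, the minimum of \<open>k\<close> and \<open>j\<close> is piecewise linear with a single bend of size
  one at \<open>k = j\<close>. So the second difference of the sum of these minima over the multiplicities
  \<open>j\<close> of \<open>p\<close> counts the multiplicities equal to \<open>k\<close>, and a prime power in which \<open>p\<close> has
  multiplicity \<open>k > 0\<close> is \<open>p\<^sup>k\<close>. The equation is arranged without differences because it is read in
  the natural numbers.
\<close>

lemma count_prime_power:
  fixes p :: nat
  assumes "Factorial_Ring.prime p" and "k > 0" and "\<forall>q\<in>set qs. primepow q"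
  shows "count (mset qs) (p ^ k) + (\<Sum>q\<leftarrow>qs. min (k - 1) (multiplicity p q))
      + (\<Sum>q\<leftarrow>qs. min (Suc k) (multiplicity p q)) = 2 * (\<Sum>q\<leftarrow>qs. min k (multiplicity p q))"
  using assms(3)
proof (induction qs)
  case (Cons q qs)
  obtain r j where rj: "Factorial_Ring.prime r" "j > 0" "q = r ^ j"
    using Cons.prems by (auto simp: primepow_def)
  have "q = p ^ k \<longleftrightarrow> multiplicity p q = k"
  proof (cases "r = p")
    case True
    thus ?thesis using rj assms(1) prime_gt_1_nat[of p] by simp
  next
    case False
    hence "\<not> p dvd q"
      using rj assms(1) by (metis prime_dvd_power primes_dvd_imp_eq)
    thus ?thesis
      using assms(2) by (auto simp: not_dvd_imp_multiplicity_0)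
  qed
  hence "(if q = p ^ k then 1 else 0) + min (k - 1) (multiplicity p q)
     + min (Suc k) (multiplicity p q) = 2 * min k (multiplicity p q)"
    using assms(2) by (auto simp: min_def)
  thus ?case using Cons by auto
qed simp

lemma mset_eq_if_torsion_eq:
  assumes "\<forall>q\<in>set qs. primepow q" and "\<forall>q\<in>set rs. primepow q"
    and "\<And>d::nat. (\<Prod>q\<leftarrow>qs. gcd d q) = (\<Prod>q\<leftarrow>rs. gcd d q)"
  shows "mset qs = mset rs"
proof (rule multiset_eqI)
  fix q
  show "count (mset qs) q = count (mset rs) q"
  proof (cases "primepow q")
    case True
    then obtain p k where q: "Factorial_Ring.prime p" "k > 0" "q = p ^ k"
      by (auto simp: primepow_def)
    have pos: "\<forall>q\<in>set qs. q > 0" "\<forall>q\<in>set rs. q > 0"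
      using assms(1,2) primepow_gt_0_nat by auto
    have "p ^ (\<Sum>q\<leftarrow>qs. min i (multiplicity p q)) = p ^ (\<Sum>q\<leftarrow>rs. min i (multiplicity p q))" for i
      using assms(3) q pos by (simp flip: prod_gcd_prime_power)
    hence "(\<Sum>q\<leftarrow>qs. min i (multiplicity p q)) = (\<Sum>q\<leftarrow>rs. min i (multiplicity p q))" for i
      using q(1) prime_gt_1_nat power_inject_exp by blast
    thus ?thesis
      using count_prime_power[OF q(1,2) assms(1)] count_prime_power[OF q(1,2) assms(2)] q(3)
      by auto
  next
    case False
    hence "q \<notin> set qs" "q \<notin> set rs" using assms by auto
    thus ?thesis by (metis not_in_iff set_mset_mset)
  qed
qed

section \<open>Sums of residue rings\<close>

text \<open>
  Only prime power moduli are used, because these make the list of moduli unique up to order.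
  Arbitrary positive moduli give the same class of rings by the Chinese remainder theorem, see
  \<open>cyclic_sum_sum_of_cyclics\<close>.
\<close>

definition sum_of_cyclics :: "('a, 'm) ring_scheme \<Rightarrow> bool"
  where "sum_of_cyclics R \<longleftrightarrow>
    ring R \<and> (\<exists>qs. (\<forall>q\<in>set qs. primepow q) \<and> R \<simeq> cyclic_sum qs)"

lemma sum_of_cyclics_ring: "sum_of_cyclics R \<Longrightarrow> ring R"
  unfolding sum_of_cyclics_def by blast

lemma sum_of_cyclics_iso:
  assumes "ring R" and "R \<simeq> S" and "sum_of_cyclics S"
  shows "sum_of_cyclics R"
proof -
  obtain qs where "\<forall>q\<in>set qs. primepow q" "S \<simeq> cyclic_sum qs"
    using assms(3) unfolding sum_of_cyclics_def by blast
  thus ?thesis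
    using assms(1) ring_iso_trans[OF assms(2)] unfolding sum_of_cyclics_def by blast
qed

lemma cyclic_sum_append:
  "cyclic_sum (ns @ ms) \<simeq> RDirProd (cyclic_sum ns) (cyclic_sum ms)"
  unfolding cyclic_sum_def map_append by (rule RDirProd_list_append)

lemma sum_of_cyclics_nil_ring: "sum_of_cyclics nil_ring"
proof -
  have "ring nil_ring"
    using RDirProd_list_ring[of "[]"] by simp
  moreover have "nil_ring \<simeq> cyclic_sum []"
    using RDirProd_list_cong[of "[]" "[]"] unfolding cyclic_sum_def by simp
  ultimately show ?thesis
    unfolding sum_of_cyclics_def by (intro conjI exI[of _ "[]"]) simp_all
qed

lemma sum_of_cyclics_RDirProd:
  assumes "sum_of_cyclics R" and "sum_of_cyclics S"
  shows "sum_of_cyclics (RDirProd R S)"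
proof -
  obtain qs rs where qs: "\<forall>q\<in>set qs. primepow q" "R \<simeq> cyclic_sum qs"
    and rs: "\<forall>q\<in>set rs. primepow q" "S \<simeq> cyclic_sum rs"
    using assms unfolding sum_of_cyclics_def by blast
  have "RDirProd R S \<simeq> RDirProd (cyclic_sum qs) (cyclic_sum rs)"
    by (rule RDirProd_cong[OF qs(2) rs(2)])
  also have "\<dots> \<simeq> cyclic_sum (qs @ rs)"
    by (rule ring_iso_sym[OF ring_cyclic_sum cyclic_sum_append])
  finally have "RDirProd R S \<simeq> cyclic_sum (qs @ rs)" .
  moreover have "ring (RDirProd R S)"
    using assms by (intro RDirProd_ring sum_of_cyclics_ring)
  ultimately show ?thesis
    using qs(1) rs(1) unfolding sum_of_cyclics_def
    by (intro conjI exI[of _ "qs @ rs"]) auto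
qed

lemma sum_of_cyclics_RDirProd_list:
  "\<forall>R\<in>set Rs. sum_of_cyclics R \<Longrightarrow> sum_of_cyclics (RDirProd_list Rs)"
proof (induction Rs)
  case Nil
  thus ?case using sum_of_cyclics_nil_ring by simp
next
  case (Cons R Rs)
  hence "sum_of_cyclics (RDirProd R (RDirProd_list Rs))"
    by (intro sum_of_cyclics_RDirProd) auto
  moreover have "ring (RDirProd_list (R # Rs))"
    using Cons.prems by (intro RDirProd_list_ring) (auto simp: sum_of_cyclics_ring)
  ultimately show ?case
    by (intro sum_of_cyclics_iso[OF _ RDirProd_list_Cons(1)])
qed

lemma ZFact_primepow_sum_of_cyclics:
  assumes "primepow q"
  shows "sum_of_cyclics (ZFact (int q))"
proof -
  have "ZFact (int q) \<simeq> cyclic_sum [q]"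
    using RDirProd_list_iso3 unfolding cyclic_sum_def is_ring_iso_def by fastforce
  thus ?thesis
    using assms ring_ZFact unfolding sum_of_cyclics_def
    by (intro conjI exI[of _ "[q]"]) simp_all
qed

lemma ZFact_sum_of_cyclics:
  assumes "n > 0"
  shows "sum_of_cyclics (ZFact (int n))"
  using assms
proof (induction n rule: less_induct)
  case (less n)
  show ?case
  proof (cases "n = 1")
    case True
    thus ?thesis
      using sum_of_cyclics_iso[OF ring_ZFact ZFact_1_nil sum_of_cyclics_nil_ring] by simp
  next
    case False
    then obtain p where p: "Factorial_Ring.prime p" "p dvd n"
      using prime_factor_nat by blast
    obtain m where m: "n = p ^ multiplicity p n * m" "\<not> p dvd m"
      using multiplicity_decompose'[of n p] less.prems p by (metis not_prime_unit not_gr_zero)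
    have k: "multiplicity p n > 0"
      using p less.prems by (simp add: prime_multiplicity_gt_zero_iff)
    define q where "q = p ^ multiplicity p n"
    have q: "primepow q"
      using p k by (auto simp: q_def primepow_def)
    have "m > 0" using m(1) less.prems by (cases m) auto
    moreover have "m < n"
      using m(1) \<open>m > 0\<close> primepow_gt_Suc_0[OF q] unfolding q_def[symmetric]
      by (metis n_less_m_mult_n)
    ultimately have "sum_of_cyclics (RDirProd (ZFact (int q)) (ZFact (int m)))"
      by (intro sum_of_cyclics_RDirProd ZFact_primepow_sum_of_cyclics[OF q] less.IH)
    moreover have "coprime q m"
      using p(1) m(2) unfolding q_def by (simp add: prime_imp_coprime)
    hence "ZFact (int q * int m) \<simeq> RDirProd (ZFact (int q)) (ZFact (int m))"
      by (intro ZFact_coprime_mult) simp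
    hence "ZFact (int n) \<simeq> RDirProd (ZFact (int q)) (ZFact (int m))"
      using m(1) unfolding q_def[symmetric] by (metis of_nat_mult)
    ultimately show ?thesis
      by (intro sum_of_cyclics_iso[OF ring_ZFact])
  qed
qed

lemma cyclic_sum_sum_of_cyclics:
  "\<forall>n\<in>set ns. 1 \<le> n \<Longrightarrow> sum_of_cyclics (cyclic_sum ns)"
  unfolding cyclic_sum_def
  by (intro sum_of_cyclics_RDirProd_list) (auto intro!: ZFact_sum_of_cyclics)

text \<open>
  The torsion counts of the additive group determine the multiset of prime power moduli, and this
  multiset determines the ring. In particular, two cyclic decompositions of one group induce
  isomorphic ring structures.
\<close>

theorem sum_of_cyclics_unique:
  assumes "sum_of_cyclics R" and "sum_of_cyclics S" and "add_monoid R \<cong> add_monoid S"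
  shows "R \<simeq> S"
proof -
  obtain qs where qs: "\<forall>q\<in>set qs. primepow q" "R \<simeq> cyclic_sum qs"
    using assms unfolding sum_of_cyclics_def by blast
  obtain rs where rs: "\<forall>q\<in>set rs. primepow q" "S \<simeq> cyclic_sum rs"
    using assms unfolding sum_of_cyclics_def by blast
  have R: "ring R" and S: "ring S"
    using assms sum_of_cyclics_ring by auto
  have pos: "\<forall>q\<in>set qs. q > 0" "\<forall>q\<in>set rs. q > 0"
    using qs(1) rs(1) primepow_gt_0_nat by auto
  have "(\<Prod>q\<leftarrow>qs. gcd d q) = (\<Prod>q\<leftarrow>rs. gcd d q)" for d
  proof -
    have "(\<Prod>q\<leftarrow>qs. gcd d q) = torsion_count (add_monoid (cyclic_sum qs)) d"
      using torsion_count_cyclic_sum[OF pos(1)] by metis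
    also have "\<dots> = torsion_count (add_monoid R) d"
      by (rule torsion_count_iso[symmetric, OF group_add_monoid[OF R]
            group_add_monoid[OF ring_cyclic_sum] add_monoid_iso[OF qs(2)]])
    also have "\<dots> = torsion_count (add_monoid S) d"
      by (rule torsion_count_iso[OF group_add_monoid[OF R] group_add_monoid[OF S] assms(3)])
    also have "\<dots> = torsion_count (add_monoid (cyclic_sum rs)) d"
      by (rule torsion_count_iso[OF group_add_monoid[OF S]
            group_add_monoid[OF ring_cyclic_sum] add_monoid_iso[OF rs(2)]])
    also have "\<dots> = (\<Prod>q\<leftarrow>rs. gcd d q)"
      using torsion_count_cyclic_sum[OF pos(2)] by metis
    finally show ?thesis .
  qed
  hence "mset qs = mset rs"
    by (rule mset_eq_if_torsion_eq[OF qs(1) rs(1)])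
  hence "cyclic_sum qs \<simeq> cyclic_sum rs"
    unfolding cyclic_sum_def by (intro RDirProd_list_map_mset ring_ZFact)
  thus ?thesis
    by (rule ring_iso_trans[OF qs(2) ring_iso_trans[OF _ ring_iso_sym[OF S rs(2)]]])
qed

section \<open>The ring of units\<close>

text \<open>
  The decomposition selected in \<open>unit_ring\<close> need not be the given one, so the list of moduli is
  only known to exist. By construction the inverse of the selected map is a ring isomorphism.
\<close>

lemma unit_ring_decomp:
  assumes "Group.monoid R" and "cyclic_decomp R ns f"
  shows "\<exists>ms. (\<forall>m\<in>set ms. 1 \<le> m) \<and> cyclic_sum ms \<simeq> unit_ring R \<and> ring (unit_ring R)"
proof -
  interpret R: Group.monoid R by fact
  obtain ms g where sel: "(SOME (ns, f). cyclic_decomp R ns f) = (ms, g)"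
    by fastforce
  have "case (ms, g) of (ns, f) \<Rightarrow> cyclic_decomp R ns f"
    unfolding sel[symmetric] by (rule someI[of _ "(ns, f)"]) (use assms in simp)
  hence ms: "\<forall>m\<in>set ms. 1 \<le> m" and g: "g \<in> iso (units_of R) (add_monoid (cyclic_sum ms))"
    by (auto simp: cyclic_decomp_def)
  define S where "S = cyclic_sum ms"
  define h where "h = inv_into (Units R) g"
  interpret S: ring S unfolding S_def by (rule ring_cyclic_sum)
  have U: "unit_ring R = \<lparr> carrier = Units R,
          monoid.mult = (\<lambda>x y. h (g x \<otimes>\<^bsub>S\<^esub> g y)),
          one = h \<one>\<^bsub>S\<^esub>,
          zero = \<one>\<^bsub>R\<^esub>,
          add = (\<otimes>\<^bsub>R\<^esub>) \<rparr>"
    unfolding unit_ring_def sel by (simp add: Let_def S_def h_def)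
  have bij: "bij_betw g (Units R) (carrier S)"
    using g unfolding iso_def S_def by (simp add: units_of_carrier)
  have g_mult: "g (x \<otimes>\<^bsub>R\<^esub> y) = g x \<oplus>\<^bsub>S\<^esub> g y" if "x \<in> Units R" "y \<in> Units R" for x y
    using g that unfolding iso_def hom_def S_def by (simp add: units_of_def)
  have hbij: "bij_betw h (carrier S) (Units R)"
    unfolding h_def by (rule bij_betw_inv_into[OF bij])
  have gh: "g (h x) = x" if "x \<in> carrier S" for x
    unfolding h_def using bij that by (rule bij_betw_inv_into_right)
  have hg: "h (g x) = x" if "x \<in> Units R" for x
    unfolding h_def using bij that by (rule bij_betw_inv_into_left)
  have hU: "h x \<in> Units R" if "x \<in> carrier S" for x
    using hbij that by (rule bij_betw_apply)
  have "h (x \<oplus>\<^bsub>S\<^esub> y) = h x \<otimes>\<^bsub>R\<^esub> h y" if "x \<in> carrier S" "y \<in> carrier S" for x y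
  proof -
    have "h x \<otimes>\<^bsub>R\<^esub> h y \<in> Units R"
      using that hU R.Units_m_closed by simp
    hence "h (g (h x \<otimes>\<^bsub>R\<^esub> h y)) = h x \<otimes>\<^bsub>R\<^esub> h y"
      by (rule hg)
    thus ?thesis
      using that by (simp add: g_mult hU gh)
  qed
  hence iso: "h \<in> ring_iso S (unit_ring R)"
    by (intro ring_iso_memI) (auto simp: U hU gh hbij)
  have "group_hom (units_of R) (add_monoid S) g"
    using g R.units_group S.add.group_axioms
    unfolding group_hom_def group_hom_axioms_def iso_def S_def by simp
  hence "g \<one>\<^bsub>R\<^esub> = \<zero>\<^bsub>S\<^esub>"
    using group_hom.hom_one by (fastforce simp: units_of_def)
  hence "h \<zero>\<^bsub>S\<^esub> = \<zero>\<^bsub>unit_ring R\<^esub>"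
    using hg[of "\<one>\<^bsub>R\<^esub>"] by (simp add: U)
  hence "ring (unit_ring R)"
    using S.ring_iso_imp_img_ring[OF iso] by simp
  thus ?thesis
    using iso ms unfolding is_ring_iso_def S_def by blast
qed

text \<open>
  The tool for identifying a unit ring: by uniqueness it suffices to compare the unit group with
  the additive group of a sum of residue rings. No explicit multiplication is ever needed.
\<close>

lemma unit_ring_sum_of_cyclics:
  assumes "ring R" and "sum_of_cyclics S" and "units_of R \<cong> add_monoid S"
  shows "sum_of_cyclics (unit_ring R)" and "unit_ring R \<simeq> S"
proof -
  obtain qs where qs: "\<forall>q\<in>set qs. primepow q" "S \<simeq> cyclic_sum qs"
    using assms(2) unfolding sum_of_cyclics_def by blast
  have "units_of R \<cong> add_monoid (cyclic_sum qs)"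
    by (rule iso_trans[OF assms(3) add_monoid_iso[OF qs(2)]])
  then obtain f where "f \<in> iso (units_of R) (add_monoid (cyclic_sum qs))"
    unfolding is_iso_def by blast
  moreover have "\<forall>q\<in>set qs. 1 \<le> q"
    using qs(1) primepow_gt_0_nat by (auto simp: Suc_le_eq)
  ultimately have "cyclic_decomp R qs f"
    unfolding cyclic_decomp_def by blast
  then obtain ms where ms: "\<forall>m\<in>set ms. 1 \<le> m" "cyclic_sum ms \<simeq> unit_ring R"
      and ring: "ring (unit_ring R)"
    using unit_ring_decomp[of R qs f] assms(1) ring.axioms(2) by blast
  show U: "sum_of_cyclics (unit_ring R)"
    by (rule sum_of_cyclics_iso[OF ring ring_iso_sym[OF ring_cyclic_sum ms(2)]
          cyclic_sum_sum_of_cyclics[OF ms(1)]])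
  show "unit_ring R \<simeq> S"
    by (rule sum_of_cyclics_unique[OF U assms(2)]) (simp only: add_monoid_unit_ring assms(3))
qed

section \<open>Groups generated by two elements\<close>

text \<open>
  If \<open>u\<close> and \<open>v\<close> generate subgroups with trivial intersection, then the map
  \<open>(x, y) \<mapsto> u\<^sup>x v\<^sup>y\<close> is injective on the product of the two residue rings, and the assumption on
  the orders makes it surjective by counting. With \<open>v = \<one>\<close> this covers cyclic groups.
\<close>

lemma (in comm_group) iso_RDirProd_ZFact:
  assumes fin: "finite (carrier G)" and u: "u \<in> carrier G" and v: "v \<in> carrier G"
    and card: "ord u * ord v = order G"
    and indep: "\<And>i j::nat. u [^] i \<otimes> v [^] j = \<one> \<Longrightarrow> ord u dvd i"
  shows "add_monoid (RDirProd (ZFact (int (ord u))) (ZFact (int (ord v)))) \<cong> G"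
proof -
  let ?m = "int (ord u)" and ?n = "int (ord v)"
  let ?D = "RDirProd (ZFact ?m) (ZFact ?n)"
  have pos: "?m > 0" "?n > 0"
    using ord_ge_1[OF fin u] ord_ge_1[OF fin v] by simp_all
  have pow_eq: "w [^] x = w [^] y \<longleftrightarrow> x mod int (ord w) = y mod int (ord w)"
    if "w \<in> carrier G" for w and x y :: int
    unfolding int_pow_eq[OF that] mod_eq_dvd_iff by (rule dvd_diff_commute)
  obtain f where f: "\<And>x. f (ZMod ?m x) = u [^] (x::int)"
    using ZMod_lift[of "\<lambda>x::int. u [^] x" ?m, OF pow_eq[OF u]] by blast
  obtain g where g: "\<And>x. g (ZMod ?n x) = v [^] (x::int)"
    using ZMod_lift[of "\<lambda>x::int. v [^] x" ?n, OF pow_eq[OF v]] by blast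
  define h where "h = (\<lambda>(X, Y). f X \<otimes> g Y)"
  have h: "h (ZMod ?m x, ZMod ?n y) = u [^] x \<otimes> v [^] y" for x y :: int
    by (simp add: h_def f g)
  have elem: "\<exists>i j :: nat. z = (ZMod ?m (int i), ZMod ?n (int j))" if "z \<in> carrier ?D" for z
  proof -
    obtain x y where "z = (ZMod ?m x, ZMod ?n y)"
      using \<open>z \<in> carrier ?D\<close> unfolding RDirProd_carrier carrier_ZFact by blast
    hence "z = (ZMod ?m (int (nat (x mod ?m))), ZMod ?n (int (nat (y mod ?n))))"
      using pos ZMod_mod by simp
    thus ?thesis by (intro exI)
  qed
  have D_add: "(ZMod ?m x, ZMod ?n y) \<oplus>\<^bsub>?D\<^esub> (ZMod ?m x', ZMod ?n y')
      = (ZMod ?m (x + x'), ZMod ?n (y + y'))" for x y x' y'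
    by (simp add: RDirProd_def DirProd_def monoid.defs)
  have D_zero: "\<zero>\<^bsub>?D\<^esub> = (ZMod ?m 0, ZMod ?n 0)"
    by (simp add: RDirProd_def DirProd_def monoid.defs ZFact_zero_eq)
  have ringD: "ring ?D"
    by (intro RDirProd_ring ring_ZFact)
  have hom: "h \<in> hom (add_monoid ?D) G"
  proof (rule homI)
    fix z assume "z \<in> carrier (add_monoid ?D)"
    hence "z \<in> carrier ?D" by simp
    from elem[OF this] obtain x y where z: "z = (ZMod ?m x, ZMod ?n y)"
      by (elim exE)
    show "h z \<in> carrier G" using u v unfolding z h by simp
  next
    fix z w assume "z \<in> carrier (add_monoid ?D)" "w \<in> carrier (add_monoid ?D)"
    hence "z \<in> carrier ?D" "w \<in> carrier ?D" by simp_all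
    with elem obtain x y x' y' where zw: "z = (ZMod ?m x, ZMod ?n y)" "w = (ZMod ?m x', ZMod ?n y')"
      by blast
    show "h (z \<otimes>\<^bsub>add_monoid ?D\<^esub> w) = h z \<otimes> h w"
      using u v unfolding zw by (simp add: D_add h int_pow_mult m_ac)
  qed
  have "inj_on h (carrier (add_monoid ?D))"
    unfolding inj_on_one_iff'[OF hom group_add_monoid[OF ringD] is_group]
  proof (intro allI impI)
    fix z assume "z \<in> carrier (add_monoid ?D)" and hz: "h z = \<one>"
    hence "z \<in> carrier ?D" by simp
    from elem[OF this] obtain i j where z: "z = (ZMod ?m (int i), ZMod ?n (int j))"
      by (elim exE)
    have uv: "u [^] i \<otimes> v [^] j = \<one>"
      using hz unfolding z h int_pow_int .
    hence i: "ord u dvd i"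
      by (rule indep)
    hence "u [^] i = \<one>"
      using pow_eq_id[OF u] by blast
    hence "v [^] j = \<one>"
      using uv v by simp
    hence "ord v dvd j"
      using pow_eq_id[OF v] by blast
    hence "ZMod ?m (int i) = ZMod ?m 0" "ZMod ?n (int j) = ZMod ?n 0"
      using i unfolding ZMod_eq_mod by (simp_all flip: of_nat_mod)
    thus "z = \<one>\<^bsub>add_monoid ?D\<^esub>"
      by (simp add: z D_zero)
  qed
  moreover have "card (carrier (add_monoid ?D)) = card (carrier G)"
    using card bij_betw_same_card[OF bij_betw_ZMod[OF pos(1)]]
      bij_betw_same_card[OF bij_betw_ZMod[OF pos(2)]]
    by (simp add: RDirProd_carrier card_cartesian_product order_def)
  moreover have "h ` carrier (add_monoid ?D) \<subseteq> carrier G"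
    using hom unfolding hom_def by (simp add: image_subset_iff Pi_iff)
  ultimately have "bij_betw h (carrier (add_monoid ?D)) (carrier G)"
    unfolding bij_betw_def using card_subset_eq[OF fin] card_image[of h] by presburger
  hence "h \<in> iso (add_monoid ?D) G"
    using hom unfolding iso_def by simp
  thus ?thesis unfolding is_iso_def by blast
qed

section \<open>Units of residue rings\<close>

lemma ZFact_Units_iff: "ZMod n x \<in> Units (ZFact n) \<longleftrightarrow> coprime x n"
proof -
  have "ZMod n x \<in> Units (ZFact n) \<longleftrightarrow> (\<exists>y. ZMod n (x * y) = ZMod n 1)"
    unfolding Units_def carrier_ZFact by (auto simp: ZFact_one_eq mult.commute)
  also have "\<dots> \<longleftrightarrow> (\<exists>y. [x * y = 1] (mod n))"
    by (simp add: ZMod_eq_mod cong_def)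
  also have "\<dots> \<longleftrightarrow> coprime x n"
    by (rule coprime_iff_invertible_int[symmetric])
  finally show ?thesis .
qed

lemma comm_group_units_ZFact: "comm_group (units_of (ZFact n))"
  using ZFact_is_cring[of n] unfolding cring_def by (blast intro: comm_monoid.units_comm_group)

lemma card_Units_ZFact:
  assumes "n > 1"
  shows "finite (Units (ZFact (int n)))" and "card (Units (ZFact (int n))) = totient n"
proof -
  have "bij_betw (\<lambda>k. ZMod (int n) (int k)) (totatives n) (Units (ZFact (int n)))"
    unfolding bij_betw_def
  proof
    show "inj_on (\<lambda>k. ZMod (int n) (int k)) (totatives n)"
    proof (rule inj_onI)
      fix k l assume kl: "k \<in> totatives n" "l \<in> totatives n"
        and "ZMod (int n) (int k) = ZMod (int n) (int l)"
      hence "k mod n = l mod n"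
        by (metis ZMod_eq_mod of_nat_eq_iff of_nat_mod)
      moreover have "k < n" "l < n"
        using kl assms totatives_less by auto
      ultimately show "k = l" by simp
    qed
    show "(\<lambda>k. ZMod (int n) (int k)) ` totatives n = Units (ZFact (int n))"
    proof (intro equalityI subsetI)
      fix X assume X: "X \<in> Units (ZFact (int n))"
      then obtain x where x: "X = ZMod (int n) x"
        unfolding Units_def carrier_ZFact by blast
      define k where "k = nat (x mod int n)"
      have k: "int k = x mod int n"
        using assms by (simp add: k_def)
      have Xk: "X = ZMod (int n) (int k)"
        using ZMod_mod x k by metis
      hence cop: "coprime k n"
        using X ZFact_Units_iff by (metis coprime_int_iff)
      have "k \<noteq> 0"
        using cop assms by (metis coprime_0_left_iff less_irrefl is_unit_gcd nat_dvd_1_iff_1)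
      moreover have "k < n"
        using k assms by (metis Euclidean_Rings.pos_mod_bound of_nat_0_less_iff of_nat_less_iff order.strict_trans zero_less_one)
      ultimately have "k \<in> totatives n"
        using cop by (simp add: in_totatives_iff)
      thus "X \<in> (\<lambda>k. ZMod (int n) (int k)) ` totatives n"
        using Xk by blast
    qed (auto simp: ZFact_Units_iff in_totatives_iff)
  qed
  thus "finite (Units (ZFact (int n)))" "card (Units (ZFact (int n))) = totient n"
    using bij_betw_finite[of _ "totatives n"] bij_betw_same_card[of _ "totatives n"]
    by (fastforce simp: totient_def)+
qed

lemma units_ZFact_pow:
  "ZMod n x [^]\<^bsub>units_of (ZFact n)\<^esub> (k :: nat) = ZMod n (x ^ k)"
  by (induction k) (simp_all add: nat_pow_def units_of_def ZFact_one_eq mult.commute)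

lemma ord_units_ZFact:
  assumes "coprime n g"
  shows "group.ord (units_of (ZFact (int n))) (ZMod (int n) (int g)) = Pocklington.ord n g"
proof -
  interpret comm_group "units_of (ZFact (int n))"
    by (rule comm_group_units_ZFact)
  have "ZMod (int n) (int g) \<in> carrier (units_of (ZFact (int n)))"
    using assms by (simp add: units_of_carrier ZFact_Units_iff coprime_commute)
  moreover have "ZMod (int n) (int g) [^]\<^bsub>units_of (ZFact (int n))\<^esub> k = \<one>\<^bsub>units_of (ZFact (int n))\<^esub>
      \<longleftrightarrow> Pocklington.ord n g dvd k" for k
  proof -
    have "ZMod (int n) (int g) [^]\<^bsub>units_of (ZFact (int n))\<^esub> k = \<one>\<^bsub>units_of (ZFact (int n))\<^esub>
      \<longleftrightarrow> int g ^ k mod int n = 1 mod int n"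
      unfolding units_ZFact_pow units_of_one ZFact_one_eq ZMod_eq_mod ..
    also have "\<dots> \<longleftrightarrow> [g ^ k = 1] (mod n)"
      unfolding cong_def by (metis of_nat_1 of_nat_eq_iff of_nat_mod of_nat_power)
    finally show ?thesis unfolding ord_divides .
  qed
  ultimately show ?thesis by (simp add: ord_unique)
qed

text \<open>
  Case \<open>v = \<one>\<close> of the lemma on two generators; the resulting trivial factor is removed.
\<close>

lemma units_of_ZFact_cyclic:
  assumes "n > 1" and "residue_primroot n g"
  shows "units_of (ZFact (int n)) \<cong> add_monoid (ZFact (int (totient n)))"
proof -
  let ?G = "units_of (ZFact (int n))"
  interpret comm_group ?G by (rule comm_group_units_ZFact)
  have g: "coprime n g" "Pocklington.ord n g = totient n"
    using assms(2) by (auto simp: residue_primroot_def)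
  define u where "u = ZMod (int n) (int g)"
  have u: "u \<in> carrier ?G"
    using g by (simp add: u_def units_of_carrier ZFact_Units_iff coprime_commute)
  have ord: "ord u = totient n"
    using ord_units_ZFact g by (simp add: u_def)
  have "ord u dvd i" if "u [^]\<^bsub>?G\<^esub> i \<otimes>\<^bsub>?G\<^esub> \<one>\<^bsub>?G\<^esub> [^]\<^bsub>?G\<^esub> j = \<one>\<^bsub>?G\<^esub>" for i j :: nat
    using that u by (simp add: pow_eq_id)
  hence "add_monoid (RDirProd (ZFact (int (ord u))) (ZFact (int (ord \<one>\<^bsub>?G\<^esub>)))) \<cong> ?G"
    using card_Units_ZFact[OF assms(1)] u ord one_closed
    by (intro iso_RDirProd_ZFact) (auto simp: units_of_carrier order_def)
  hence "add_monoid (RDirProd (ZFact (int (totient n))) (ZFact 1)) \<cong> ?G"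
    using ord by simp
  hence "?G \<cong> add_monoid (RDirProd (ZFact (int (totient n))) (ZFact 1))"
    by (intro group.iso_sym[OF group_add_monoid] RDirProd_ring ring_ZFact)
  also have "\<dots> \<cong> add_monoid (ZFact (int (totient n)))"
    by (intro add_monoid_iso RDirProd_ZFact_1 ring_ZFact)
  finally show ?thesis .
qed

text \<open>
  The units modulo \<open>2\<^sup>k\<close> are the direct product of the subgroup generated by \<open>- 1\<close>, of order
  \<open>2\<close>, and the one generated by \<open>5\<close>, of order \<open>2\<^sup>k\<^sup>-\<^sup>2\<close>. They meet trivially because
  all powers of \<open>5\<close> are \<open>1\<close> modulo \<open>4\<close>, while odd powers of \<open>- 1\<close> are not.
\<close>

lemma units_of_ZFact_twopow:
  assumes "k \<ge> 3"
  shows "units_of (ZFact (int (2 ^ k))) \<cong> add_monoid (RDirProd (ZFact 2) (ZFact (int (2 ^ (k - 2)))))"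
proof -
  define n :: nat where "n = 2 ^ k"
  let ?G = "units_of (ZFact (int n))"
  interpret comm_group ?G by (rule comm_group_units_ZFact)
  have "(4 :: int) dvd int n"
    using le_imp_power_dvd[of 2 k "2 :: int"] assms by (simp add: n_def)
  have n: "n \<ge> 8"
    using power_increasing[of 3 k "2 :: nat"] assms by (simp add: n_def)
  define u where "u = ZMod (int n) (- 1)"
  define v where "v = ZMod (int n) (int 5)"
  have u: "u \<in> carrier ?G"
    by (simp add: u_def units_of_carrier ZFact_Units_iff)
  have cop5: "coprime n 5"
    unfolding n_def by simp
  have v: "v \<in> carrier ?G"
    using cop5 unfolding v_def units_of_carrier ZFact_Units_iff coprime_int_iff
    by (simp add: coprime_commute)
  have ord_v: "ord v = 2 ^ (k - 2)"
    using ord_units_ZFact[OF cop5] ord_twopow_3_5[of k 5] assms by (simp add: v_def n_def)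
  have indep: "even i" if "u [^]\<^bsub>?G\<^esub> i \<otimes>\<^bsub>?G\<^esub> v [^]\<^bsub>?G\<^esub> j = \<one>\<^bsub>?G\<^esub>" for i j :: nat
  proof (rule ccontr)
    assume "odd i"
    have "ZMod (int n) ((- 1) ^ i * 5 ^ j) = ZMod (int n) 1"
      using that unfolding u_def v_def units_ZFact_pow units_of_mult units_of_one
      by (simp add: ZFact_one_eq)
    hence "4 dvd (- 1) ^ i * 5 ^ j - (1::int)"
      using \<open>4 dvd int n\<close> unfolding ZMod_eq_mod mod_eq_dvd_iff by (rule dvd_trans[rotated])
    hence "4 dvd 5 ^ j + (1::int)"
      using \<open>odd i\<close> dvd_minus_iff[of 4 "5 ^ j + (1::int)"] by simp
    moreover have "(5::int) ^ j mod 4 = 1"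
      by (simp flip: power_mod[of "5 :: int"])
    hence "\<not> 4 dvd 5 ^ j + (1::int)"
      by presburger
    ultimately show False by contradiction
  qed
  have ord_u: "ord u = 2"
  proof -
    have "u [^]\<^bsub>?G\<^esub> i = \<one>\<^bsub>?G\<^esub> \<longleftrightarrow> 2 dvd i" for i :: nat
    proof
      assume "u [^]\<^bsub>?G\<^esub> i = \<one>\<^bsub>?G\<^esub>"
      thus "2 dvd i" using indep[of i 0] by simp
    next
      assume "2 dvd i"
      thus "u [^]\<^bsub>?G\<^esub> i = \<one>\<^bsub>?G\<^esub>"
        unfolding u_def units_ZFact_pow units_of_one ZFact_one_eq by simp
    qed
    thus ?thesis using u by (simp add: ord_unique)
  qed
  obtain l where l: "k = Suc (Suc l)"
    using assms by (metis add_2_eq_Suc le_Suc_ex numeral_3_eq_3 add_Suc)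
  have "totient n = 2 * 2 ^ (k - 2)"
    using totient_prime_power_Suc[of 2 "Suc l"] by (simp add: n_def l)
  hence "add_monoid (RDirProd (ZFact (int (ord u))) (ZFact (int (ord v)))) \<cong> ?G"
    using card_Units_ZFact[of n] n ord_u ord_v
    by (intro iso_RDirProd_ZFact u v) (simp_all add: units_of_carrier order_def indep)
  hence "add_monoid (RDirProd (ZFact 2) (ZFact (int (2 ^ (k - 2))))) \<cong> ?G"
    using ord_u ord_v by simp
  thus ?thesis
    unfolding n_def by (intro group.iso_sym[OF group_add_monoid] RDirProd_ring ring_ZFact)
qed

lemma unit_ring_ZFact_primepow:
  assumes "primepow q"
  shows "sum_of_cyclics (unit_ring (ZFact (int q)))"
proof -
  obtain p k where q: "Factorial_Ring.prime p" "k > 0" "q = p ^ k"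
    using assms by (auto simp: primepow_def)
  have q1: "q > 1"
    using primepow_gt_Suc_0[OF assms] by simp
  show ?thesis
  proof (cases "p = 2 \<and> k \<ge> 3")
    case True
    have "sum_of_cyclics (RDirProd (ZFact 2) (ZFact (int (2 ^ (k - 2)))))"
      using ZFact_sum_of_cyclics[of 2] ZFact_sum_of_cyclics[of "2 ^ (k - 2)"]
      by (intro sum_of_cyclics_RDirProd) simp_all
    moreover have "units_of (ZFact (int q)) \<cong> add_monoid (RDirProd (ZFact 2) (ZFact (int (2 ^ (k - 2)))))"
      using units_of_ZFact_twopow[of k] True q(3) by simp
    ultimately show ?thesis
      by (rule unit_ring_sum_of_cyclics(1)[OF ring_ZFact])
  next
    case False
    have "\<exists>g. residue_primroot q g"
    proof (cases "p = 2")
      case True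
      hence "k = 1 \<or> k = 2"
        using False q by linarith
      hence "q = 2 \<or> q = 4"
        using True q by auto
      thus ?thesis
        using residue_primroot_iff_in_cyclic_moduli[of q] by (auto simp: cyclic_moduli_def)
    next
      case False
      hence "odd p" using q(1) prime_odd_nat prime_ge_2_nat by (metis le_neq_implies_less)
      thus ?thesis
        using residue_primroot_odd_prime_power_exists[OF q(1)] q by metis
    qed
    then obtain g where "residue_primroot q g" ..
    hence "units_of (ZFact (int q)) \<cong> add_monoid (ZFact (int (totient q)))"
      by (rule units_of_ZFact_cyclic[OF q1])
    moreover have "sum_of_cyclics (ZFact (int (totient q)))"
      using q1 by (intro ZFact_sum_of_cyclics) simp
    ultimately show ?thesis
      by (intro unit_ring_sum_of_cyclics(1)[OF ring_ZFact])
  qed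
qed

section \<open>Units of direct products\<close>

text \<open>
  For two factors the unit group of the product is literally the product of the unit groups, which
  are the additive groups of the unit rings.
\<close>

lemma units_of_RDirProd_list:
  assumes "\<forall>R\<in>set Rs. ring R"
  shows "units_of (RDirProd_list Rs) \<cong> add_monoid (RDirProd_list (map unit_ring Rs))"
  using assms
proof (induction Rs)
  case Nil
  have "units_of (nil_ring :: 'a list ring) = add_monoid nil_ring"
    by (simp add: units_of_def Units_def monoid.defs)
  thus ?case
    by (simp only: RDirProd_list_nil list.map iso_refl)
next
  case (Cons R Rs)
  have "units_of (RDirProd_list (R # Rs)) \<cong> units_of (RDirProd R (RDirProd_list Rs))"
    using Cons.prems
    by (intro units_of_iso RDirProd_list_Cons RDirProd_list_ring RDirProd_ring) auto
  also have "\<dots> = units_of R \<times>\<times> units_of (RDirProd_list Rs)"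
    by (rule units_of_RDirProd)
  also have "\<dots> = add_monoid (unit_ring R) \<times>\<times> units_of (RDirProd_list Rs)"
    by (simp only: add_monoid_unit_ring)
  also have "\<dots> \<cong> add_monoid (unit_ring R) \<times>\<times> add_monoid (RDirProd_list (map unit_ring Rs))"
    using Cons by (intro DirProd_is_iso iso_refl) auto
  also have "\<dots> = add_monoid (RDirProd (unit_ring R) (RDirProd_list (map unit_ring Rs)))"
    by (rule RDirProd_add_monoid[symmetric])
  also have "\<dots> \<cong> add_monoid (RDirProd_list (map unit_ring (R # Rs)))"
    unfolding list.map by (intro add_monoid_iso RDirProd_list_Cons)
  finally show ?case .
qed

lemma unit_ring_RDirProd_list:
  assumes "\<forall>R\<in>set Rs. ring R \<and> sum_of_cyclics (unit_ring R)"
  shows "sum_of_cyclics (unit_ring (RDirProd_list Rs))"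
    and "unit_ring (RDirProd_list Rs) \<simeq> RDirProd_list (map unit_ring Rs)"
proof -
  have ring: "ring (RDirProd_list Rs)"
    using assms by (intro RDirProd_list_ring) blast
  have soc: "sum_of_cyclics (RDirProd_list (map unit_ring Rs))"
    using assms by (intro sum_of_cyclics_RDirProd_list) simp
  have units: "units_of (RDirProd_list Rs) \<cong> add_monoid (RDirProd_list (map unit_ring Rs))"
    using assms by (intro units_of_RDirProd_list) blast
  show "sum_of_cyclics (unit_ring (RDirProd_list Rs))"
    by (rule unit_ring_sum_of_cyclics(1)[OF ring soc units])
  show "unit_ring (RDirProd_list Rs) \<simeq> RDirProd_list (map unit_ring Rs)"
    by (rule unit_ring_sum_of_cyclics(2)[OF ring soc units])
qed

text \<open>
  The existence of cyclic decompositions for unit groups; it keeps the iteration inside the class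
  on which units respect isomorphisms and products.
\<close>

lemma sum_of_cyclics_unit_ring:
  assumes "sum_of_cyclics R"
  shows "sum_of_cyclics (unit_ring R)"
proof -
  obtain qs where qs: "\<forall>q\<in>set qs. primepow q" "R \<simeq> cyclic_sum qs"
    using assms unfolding sum_of_cyclics_def by blast
  have ring: "ring R"
    using assms by (rule sum_of_cyclics_ring)
  have "sum_of_cyclics (unit_ring (cyclic_sum qs))"
    unfolding cyclic_sum_def using qs(1)
    by (intro unit_ring_RDirProd_list(1)) (auto simp: ring_ZFact unit_ring_ZFact_primepow)
  moreover have "units_of R \<cong> add_monoid (unit_ring (cyclic_sum qs))"
    unfolding add_monoid_unit_ring by (rule units_of_iso[OF ring ring_cyclic_sum qs(2)])
  ultimately show ?thesis
    by (rule unit_ring_sum_of_cyclics(1)[OF ring])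
qed

lemma unit_ring_cong:
  assumes "sum_of_cyclics R" and "sum_of_cyclics S" and "R \<simeq> S"
  shows "unit_ring R \<simeq> unit_ring S"
proof (rule unit_ring_sum_of_cyclics(2))
  show "ring R"
    using assms(1) by (rule sum_of_cyclics_ring)
  show "sum_of_cyclics (unit_ring S)"
    using assms(2) by (rule sum_of_cyclics_unit_ring)
  show "units_of R \<cong> add_monoid (unit_ring S)"
    unfolding add_monoid_unit_ring
    by (rule units_of_iso[OF sum_of_cyclics_ring[OF assms(1)] sum_of_cyclics_ring[OF assms(2)] assms(3)])
qed

section \<open>Iterated groups of units\<close>

lemma gen_units_sum_of_cyclics:
  "sum_of_cyclics R \<Longrightarrow> sum_of_cyclics (gen_units k R)"
  by (induction k) (simp_all add: sum_of_cyclics_unit_ring)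

lemma unit_ring_ZFact_odd_prime_power:
  assumes p: "Factorial_Ring.prime p" "odd p" and "k > 0"
  shows "unit_ring (ZFact (int (p ^ k))) \<simeq> ZFact (int (p ^ (k - 1) * (p - 1)))"
proof -
  have gt: "p ^ k > 1"
    by (rule one_less_power[OF prime_gt_1_nat[OF p(1)] \<open>k > 0\<close>])
  obtain g where "residue_primroot (p ^ k) g"
    using residue_primroot_odd_prime_power_exists[OF p] \<open>k > 0\<close> by blast
  hence "units_of (ZFact (int (p ^ k))) \<cong> add_monoid (ZFact (int (totient (p ^ k))))"
    by (rule units_of_ZFact_cyclic[OF gt])
  moreover have "sum_of_cyclics (ZFact (int (totient (p ^ k))))"
    using prime_gt_0_nat[OF p(1)] by (intro ZFact_sum_of_cyclics) simp
  ultimately have "unit_ring (ZFact (int (p ^ k))) \<simeq> ZFact (int (totient (p ^ k)))"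
    by (intro unit_ring_sum_of_cyclics(2)[OF ring_ZFact])
  thus ?thesis
    using totient_prime_power[OF p(1) \<open>k > 0\<close>] by simp
qed

text \<open>
  The step that produces a new factor: \<open>p - 1\<close> is coprime to \<open>p\<^sup>k\<close>, and \<open>\<int>\<close> modulo \<open>p - 1\<close>
  is the unit ring of \<open>\<int>\<close> modulo \<open>p\<close>.
\<close>

lemma unit_ring_ZFact_split:
  assumes p: "Factorial_Ring.prime p" "odd p"
  shows "unit_ring (ZFact (int (p ^ Suc k))) \<simeq> RDirProd (unit_ring (ZFact (int p))) (ZFact (int (p ^ k)))"
proof -
  have "coprime (int (p - 1)) (int (p ^ k))"
    using coprime_diff_one_left_nat[OF prime_gt_0_nat[OF p(1)]]
    unfolding coprime_int_iff by (rule coprime_power_right_iff[THEN iffD2, OF disjI1])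
  have "unit_ring (ZFact (int (p ^ Suc k))) \<simeq> ZFact (int (p - 1) * int (p ^ k))"
    using unit_ring_ZFact_odd_prime_power[OF p, of "Suc k"] by (simp add: mult.commute)
  also have "\<dots> \<simeq> RDirProd (ZFact (int (p - 1))) (ZFact (int (p ^ k)))"
    by (rule ZFact_coprime_mult) fact
  also have "\<dots> \<simeq> RDirProd (unit_ring (ZFact (int p))) (ZFact (int (p ^ k)))"
  proof (rule RDirProd_cong[OF ring_iso_sym ring_iso_refl])
    show "unit_ring (ZFact (int p)) \<simeq> ZFact (int (p - 1))"
      using unit_ring_ZFact_odd_prime_power[OF p, of 1] by simp
    show "ring (unit_ring (ZFact (int p)))"
      using prime_gt_0_nat[OF p(1)]
      by (intro sum_of_cyclics_ring sum_of_cyclics_unit_ring ZFact_sum_of_cyclics)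
  qed
  finally show ?thesis .
qed

lemma map_gen_units_Suc:
  "map unit_ring (map (\<lambda>j. gen_units j R) (rev [a..<b])) = map (\<lambda>j. gen_units j R) (rev [Suc a..<Suc b])"
  by (simp add: map_Suc_upt[symmetric] rev_map comp_def del: upt_Suc)

text \<open>
  The form with a last factor that is still a residue ring of \<open>p\<close>-power order is the one that can be
  proved by induction. It includes \<open>k = \<alpha>\<close>, where this factor is the zero ring.
\<close>

lemma gen_units_prime_power_le:
  fixes p :: nat
  assumes p: "Factorial_Ring.prime p" "odd p" and "k \<le> \<alpha>"
  shows "gen_units k (ZFact (int (p ^ \<alpha>))) \<simeq>
    RDirProd_list (map (\<lambda>j. gen_units j (ZFact (int p))) (rev [1..<k + 1]) @ [ZFact (int (p ^ (\<alpha> - k)))])"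
  using \<open>k \<le> \<alpha>\<close>
proof (induction k)
  case 0
  show ?case
    using RDirProd_list_iso3 unfolding is_ring_iso_def by fastforce
next
  case (Suc k)
  have pos: "p > 0" using prime_gt_0_nat[OF p(1)] .
  have soc: "sum_of_cyclics (gen_units j (ZFact (int (p ^ i))))" for i j
    using pos by (intro gen_units_sum_of_cyclics ZFact_sum_of_cyclics) simp
  have socp: "sum_of_cyclics (gen_units j (ZFact (int p)))" for j
    using soc[of j 1] by simp
  let ?U = "\<lambda>j. gen_units j (ZFact (int p))"
  let ?L = "map ?U (rev [1..<k + 1])"
  have socs: "\<forall>R\<in>set (?L @ [ZFact (int (p ^ (\<alpha> - k)))]). sum_of_cyclics R"
    using socp soc[of 0] by auto
  have rest: "\<alpha> - k = Suc (\<alpha> - Suc k)"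
    using Suc.prems by simp
  have ring: "ring (unit_ring (ZFact (int (p ^ Suc i))))" for i
    using sum_of_cyclics_ring[OF soc[of 1 "Suc i"]] by simp
  have "gen_units (Suc k) (ZFact (int (p ^ \<alpha>))) \<simeq>
      unit_ring (RDirProd_list (?L @ [ZFact (int (p ^ (\<alpha> - k)))]))"
    unfolding gen_units.simps using Suc.prems
    by (intro unit_ring_cong soc sum_of_cyclics_RDirProd_list[OF socs] Suc.IH) simp
  also have "\<dots> \<simeq> RDirProd_list (map unit_ring (?L @ [ZFact (int (p ^ (\<alpha> - k)))]))"
    using socs sum_of_cyclics_ring sum_of_cyclics_unit_ring by (intro unit_ring_RDirProd_list(2)) blast
  also have "map unit_ring (?L @ [ZFact (int (p ^ (\<alpha> - k)))])
      = map ?U (rev [Suc 1..<Suc (k + 1)]) @ [unit_ring (ZFact (int (p ^ Suc (\<alpha> - Suc k))))]"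
    unfolding map_append map_gen_units_Suc rest by simp
  also have "RDirProd_list \<dots> \<simeq>
      RDirProd (RDirProd_list (map ?U (rev [Suc 1..<Suc (k + 1)])))
        (RDirProd_list [unit_ring (ZFact (int (p ^ Suc (\<alpha> - Suc k))))])"
    by (rule RDirProd_list_append)
  also have "\<dots> \<simeq> RDirProd (RDirProd_list (map ?U (rev [Suc 1..<Suc (k + 1)])))
        (RDirProd_list [unit_ring (ZFact (int p)), ZFact (int (p ^ (\<alpha> - Suc k)))])"
  proof (rule RDirProd_cong[OF ring_iso_refl])
    have "RDirProd_list [unit_ring (ZFact (int (p ^ Suc (\<alpha> - Suc k))))]
        \<simeq> unit_ring (ZFact (int (p ^ Suc (\<alpha> - Suc k))))"
      using RDirProd_list_iso3 by (intro ring_iso_sym[OF ring]) (auto simp: is_ring_iso_def)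
    also have "\<dots> \<simeq> RDirProd (unit_ring (ZFact (int p))) (ZFact (int (p ^ (\<alpha> - Suc k))))"
      by (rule unit_ring_ZFact_split[OF p])
    also have "\<dots> \<simeq> RDirProd (unit_ring (ZFact (int p))) (RDirProd_list [ZFact (int (p ^ (\<alpha> - Suc k)))])"
      using RDirProd_list_iso3 by (intro RDirProd_cong ring_iso_refl) (auto simp: is_ring_iso_def)
    also have "\<dots> \<simeq> RDirProd_list [unit_ring (ZFact (int p)), ZFact (int (p ^ (\<alpha> - Suc k)))]"
      by (rule RDirProd_list_Cons(2))
    finally show "RDirProd_list [unit_ring (ZFact (int (p ^ Suc (\<alpha> - Suc k))))]
        \<simeq> RDirProd_list [unit_ring (ZFact (int p)), ZFact (int (p ^ (\<alpha> - Suc k)))]" .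
  qed
  also have "\<dots> \<simeq> RDirProd_list (map ?U (rev [Suc 1..<Suc (k + 1)])
      @ [unit_ring (ZFact (int p)), ZFact (int (p ^ (\<alpha> - Suc k)))])"
    using socp[THEN sum_of_cyclics_ring] ring[of 0] ring_ZFact
    by (intro ring_iso_sym[OF RDirProd_list_ring RDirProd_list_append]) auto
  also have "map ?U (rev [Suc 1..<Suc (k + 1)])
      @ [unit_ring (ZFact (int p)), ZFact (int (p ^ (\<alpha> - Suc k)))]
    = map ?U (rev [1..<Suc k + 1]) @ [ZFact (int (p ^ (\<alpha> - Suc k)))]"
    by (simp add: upt_conv_Cons[of "Suc 0" "Suc (Suc k)"] del: upt_Suc)
  finally show ?case .
qed

lemma gen_units_prime_power_eq:
  fixes p :: nat
  assumes p: "Factorial_Ring.prime p" "odd p"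
  shows "gen_units \<alpha> (ZFact (int (p ^ \<alpha>))) \<simeq>
    RDirProd_list (map (\<lambda>j. gen_units j (ZFact (int p))) (rev [1..<\<alpha> + 1]))"
proof -
  let ?L = "map (\<lambda>j. gen_units j (ZFact (int p))) (rev [1..<\<alpha> + 1])"
  have soc: "sum_of_cyclics (gen_units j (ZFact (int p)))" for j
    using prime_gt_0_nat[OF p(1)] by (intro gen_units_sum_of_cyclics ZFact_sum_of_cyclics)
  have ring: "ring (RDirProd_list ?L)"
    using soc[THEN sum_of_cyclics_ring] by (intro RDirProd_list_ring) auto
  have "gen_units \<alpha> (ZFact (int (p ^ \<alpha>))) \<simeq> RDirProd_list (?L @ [ZFact 1])"
    using gen_units_prime_power_le[OF p, of \<alpha> \<alpha>] by simp
  also have "\<dots> \<simeq> RDirProd (RDirProd_list ?L) (RDirProd_list [ZFact 1])"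
    by (rule RDirProd_list_append)
  also have "\<dots> \<simeq> RDirProd (RDirProd_list ?L) (ZFact 1)"
    using RDirProd_list_iso3
    by (intro RDirProd_cong[OF ring_iso_refl] ring_iso_sym[OF ring_ZFact]) (auto simp: is_ring_iso_def)
  also have "\<dots> \<simeq> RDirProd_list ?L"
    by (rule RDirProd_ZFact_1[OF ring])
  finally show ?thesis .
qed

text \<open>
  Once no residue ring of \<open>p\<close>-power order is left, taking units only shifts the exponents.
\<close>

lemma gen_units_prime_power_ge:
  fixes p :: nat
  assumes p: "Factorial_Ring.prime p" "odd p"
  shows "gen_units (\<alpha> + d) (ZFact (int (p ^ \<alpha>))) \<simeq>
    RDirProd_list (map (\<lambda>j. gen_units j (ZFact (int p))) (rev [d + 1..<\<alpha> + d + 1]))"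
proof (induction d)
  case 0
  show ?case using gen_units_prime_power_eq[OF p] by simp
next
  case (Suc d)
  let ?U = "\<lambda>j. gen_units j (ZFact (int p))"
  have soc: "sum_of_cyclics (gen_units j (ZFact (int (p ^ i))))" for i j
    using prime_gt_0_nat[OF p(1)] by (intro gen_units_sum_of_cyclics ZFact_sum_of_cyclics) simp
  have socs: "\<forall>R\<in>set (map ?U (rev [d + 1..<\<alpha> + d + 1])). sum_of_cyclics R"
    using soc[of _ 1] by auto
  have "gen_units (\<alpha> + Suc d) (ZFact (int (p ^ \<alpha>))) = unit_ring (gen_units (\<alpha> + d) (ZFact (int (p ^ \<alpha>))))"
    by simp
  also have "\<dots> \<simeq> unit_ring (RDirProd_list (map ?U (rev [d + 1..<\<alpha> + d + 1])))"
    by (intro unit_ring_cong soc sum_of_cyclics_RDirProd_list[OF socs] Suc.IH)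
  also have "\<dots> \<simeq> RDirProd_list (map unit_ring (map ?U (rev [d + 1..<\<alpha> + d + 1])))"
    using socs sum_of_cyclics_ring sum_of_cyclics_unit_ring by (intro unit_ring_RDirProd_list(2)) blast
  also have "map unit_ring (map ?U (rev [d + 1..<\<alpha> + d + 1])) = map ?U (rev [Suc d + 1..<\<alpha> + Suc d + 1])"
    unfolding map_gen_units_Suc by simp
  finally show ?case .
qed

theorem theorem7:
  fixes p \<alpha> k :: nat
  assumes "Factorial_Ring.prime p" and "odd p" and "\<alpha> > 0" and "k > 0"
  shows "(\<alpha> < k \<longrightarrow>
            gen_units k (ZFact (int (p ^ \<alpha>))) \<simeq>
            RDirProd_list (map (\<lambda>j. gen_units j (ZFact (int p))) (rev [k - \<alpha> + 1..<k + 1]))) \<and>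
         (\<alpha> = k \<longrightarrow>
            gen_units k (ZFact (int (p ^ \<alpha>))) \<simeq>
            RDirProd_list (map (\<lambda>j. gen_units j (ZFact (int p))) (rev [1..<k + 1]))) \<and>
         (\<alpha> > k \<longrightarrow>
            gen_units k (ZFact (int (p ^ \<alpha>))) \<simeq>
            RDirProd_list (map (\<lambda>j. gen_units j (ZFact (int p))) (rev [1..<k + 1])
                           @ [ZFact (int (p ^ (\<alpha> - k)))]))"
proof (intro conjI impI)
  note p = assms(1,2)
  assume "\<alpha> < k"
  then obtain d where "k = \<alpha> + d"
    using less_imp_add_positive by blast
  thus "gen_units k (ZFact (int (p ^ \<alpha>))) \<simeq>
      RDirProd_list (map (\<lambda>j. gen_units j (ZFact (int p))) (rev [k - \<alpha> + 1..<k + 1]))"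
    using gen_units_prime_power_ge[OF p, of \<alpha> d] by simp
next
  assume "\<alpha> = k"
  thus "gen_units k (ZFact (int (p ^ \<alpha>))) \<simeq>
      RDirProd_list (map (\<lambda>j. gen_units j (ZFact (int p))) (rev [1..<k + 1]))"
    using gen_units_prime_power_eq[OF assms(1,2)] by simp
next
  assume "\<alpha> > k"
  thus "gen_units k (ZFact (int (p ^ \<alpha>))) \<simeq>
      RDirProd_list (map (\<lambda>j. gen_units j (ZFact (int p))) (rev [1..<k + 1])
                     @ [ZFact (int (p ^ (\<alpha> - k)))])"
    by (intro gen_units_prime_power_le assms) simp
qed

end
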